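(* Let $r\ge 0$, $m$, $n$ and $k$ be integers with $1\le k\le m-r$ and $k\le n$. If $n\ge (k-1)\binom{m}{r+k-1}$, then $$N(n,k,m;r)=(r+k)n-(k-1)\binom{m}{r+k-1}.$$
   Context: For a nonnegative integer $s$, $[s]=\{1,\dots,s\}$. An $r\text{-ECBC}(n,k,m)$ (erasure combinatorial batch code with redundancy $r$, with at most one item read from each server) is a multifamily $\mathcal{B}=\{B_1,\dots,B_m\}$ of $m$ subsets of $[n]$ such that for each $Y\subseteq[n]$ with $|Y|\le k$ and each $J\subseteq[m]$ with $|J|\ge m-r$ there exist subsets $C_j\subseteq B_j$ ($j\in J$) with $|C_j|\le 1$ and $Y=\bigcup_{j\in J}C_j$. Its weight is $N(\mathcal{B})=|B_1|+\cdots+|B_m|$. $N(n,k,m;r)$ denotes the minimum weight of an $r\text{-ECBC}(n,k,m)$. *)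

theory Defs
  imports Complex_Main
begin

text \<open>
  A multifamily of \<open>m\<close> subsets of \<open>[n] = {1..n}\<close> is a function \<open>B\<close> on indices, of which only
  the values at \<open>{1..m}\<close> matter; repeated sets are allowed.
\<close>

definition is_ecbc :: "nat \<Rightarrow> nat \<Rightarrow> nat \<Rightarrow> nat \<Rightarrow> (nat \<Rightarrow> nat set) \<Rightarrow> bool" where
  "is_ecbc r n k m B \<longleftrightarrow>
     (\<forall>j\<in>{1..m}. B j \<subseteq> {1..n}) \<and>
     (\<forall>Y J. Y \<subseteq> {1..n} \<and> card Y \<le> k \<and> J \<subseteq> {1..m} \<and> card J \<ge> m - r \<longrightarrow>
        (\<exists>C. (\<forall>j\<in>J. C j \<subseteq> B j \<and> card (C j) \<le> 1) \<and> Y = (\<Union>j\<in>J. C j)))"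

definition weight :: "nat \<Rightarrow> (nat \<Rightarrow> nat set) \<Rightarrow> nat" where
  "weight m B = (\<Sum>j\<in>{1..m}. card (B j))"

definition min_weight :: "nat \<Rightarrow> nat \<Rightarrow> nat \<Rightarrow> nat \<Rightarrow> nat" where
  "min_weight n k m r = (LEAST w. \<exists>B. is_ecbc r n k m B \<and> w = weight m B)"

text \<open>The minimum is over a nonempty set, hence attained, whenever \<open>k \<le> m - r\<close>.\<close>

lemma is_ecbc_full:
  assumes "k \<le> m - r"
  shows "is_ecbc r n k m (\<lambda>_. {1..n})"
  unfolding is_ecbc_def
proof (intro conjI allI impI ballI)
  fix Y J :: "nat set"
  assume *: "Y \<subseteq> {1..n} \<and> card Y \<le> k \<and> J \<subseteq> {1..m} \<and> card J \<ge> m - r"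
  have "finite Y" "finite J"
    using * finite_subset[of Y "{1..n}"] finite_subset[of J "{1..m}"] by simp_all
  moreover have "card Y \<le> card J"
    using * assms by linarith
  ultimately obtain f where f: "f ` Y \<subseteq> J" "inj_on f Y"
    using card_le_inj[of Y J] by metis
  let ?C = "\<lambda>j. {y \<in> Y. f y = j}"
  have "card (?C j) \<le> 1" for j
    using f(2) \<open>finite Y\<close> by (simp add: card_le_Suc0_iff_eq inj_on_def)
  moreover have "?C j \<subseteq> {1..n}" for j
    using * by blast
  moreover have "Y = (\<Union>j\<in>J. ?C j)"
    using f(1) by blast
  ultimately show "\<exists>C. (\<forall>j\<in>J. C j \<subseteq> {1..n} \<and> card (C j) \<le> 1) \<and> Y = (\<Union>j\<in>J. C j)"
    by (intro exI[of _ ?C] conjI ballI)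
qed simp

lemma min_weight_attained:
  assumes "k \<le> m - r"
  shows "\<exists>B. is_ecbc r n k m B \<and> min_weight n k m r = weight m B"
  unfolding min_weight_def
  by (rule LeastI_ex) (use is_ecbc_full[OF assms] in blast)

lemma min_weight_le:
  assumes "is_ecbc r n k m B"
  shows "min_weight n k m r \<le> weight m B"
  unfolding min_weight_def by (rule Least_le) (use assms in blast)

end

theory Submission
  imports Defs
begin

text \<open>
  Read the code from the side of the items: item \<open>x\<close> is stored on the set \<open>T x\<close> of servers, and
  the weight is \<open>\<Sum>x. card (T x)\<close>.  Storing every item on \<open>r + k\<close> servers is certainly enough, so
  the question is how much can be saved, that is, how large the sum of the deficiencies
  \<open>r + k - card (T x)\<close> can be.  The savings are limited by the servers' subsets of size
  \<open>s = r + k - 1\<close>: if \<open>r\<close> servers of such a set \<open>S\<close> fail, only \<open>k - 1\<close> are left, so at most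
  \<open>k - 1\<close> items have \<open>T x \<subseteq> S\<close> (lemma \<open>few_items_inside\<close>).  On the other hand an item with
  deficiency \<open>d\<close> lies inside at least \<open>d\<close> of these sets \<open>S\<close> (lemma \<open>deficiency_le_supersets\<close>).
  Counting the pairs \<open>T x \<subseteq> S\<close> in both ways bounds the total saving by
  \<open>(k - 1) * (m choose s)\<close>.

  The bound is attained by assigning exactly \<open>k - 1\<close> items to each \<open>S\<close> and storing every
  remaining item on \<open>r + k\<close> servers; this is where \<open>n\<close> has to be large.  After any \<open>r\<close> failures
  every item keeps at least \<open>k - 1\<close> servers, and any \<open>k\<close> items together keep at least \<open>k\<close>, since
  otherwise all of them would be stored on one and the same \<open>S\<close>.  Under such nearly sufficient
  cardinalities distinct servers can be chosen almost greedily (lemma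
  \<open>distinct_reps_of_card\<close>), which is the required way of reading the items.
\<close>

section \<open>Codes as families of server sets\<close>

definition servers :: "nat \<Rightarrow> (nat \<Rightarrow> nat set) \<Rightarrow> nat \<Rightarrow> nat set" where
  "servers m B x = {j \<in> {1..m}. x \<in> B j}"

lemma weight_eq_sum_servers:
  assumes "\<forall>j\<in>{1..m}. B j \<subseteq> {1..n}"
  shows "weight m B = (\<Sum>x\<in>{1..n}. card (servers m B x))"
proof -
  have "weight m B = (\<Sum>j\<in>{1..m}. \<Sum>x\<in>{1..n}. if x \<in> B j then 1 else 0)"
    unfolding weight_def
  proof (rule sum.cong)
    fix j assume "j \<in> {1..m}"
    with assms have "{x \<in> {1..n}. x \<in> B j} = B j" by blast
    then show "card (B j) = (\<Sum>x\<in>{1..n}. if x \<in> B j then 1 else 0)"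
      by (simp flip: sum.inter_filter)
  qed simp
  also have "\<dots> = (\<Sum>x\<in>{1..n}. \<Sum>j\<in>{1..m}. if x \<in> B j then 1 else 0)"
    by (rule sum.swap)
  also have "\<dots> = (\<Sum>x\<in>{1..n}. card (servers m B x))"
    unfolding servers_def by (simp flip: sum.inter_filter)
  finally show ?thesis .
qed

section \<open>The lower bound\<close>

text \<open>
  Let \<open>r\<close> servers of \<open>S\<close> fail.  All items stored inside \<open>S\<close> must then be read from the other
  \<open>k - 1\<close> servers of \<open>S\<close>, one item from each, so \<open>k\<close> of them cannot be recovered together.
\<close>

lemma few_items_inside:
  assumes ecbc: "is_ecbc r n k m B" and "1 \<le> k"
    and S: "S \<subseteq> {1..m}" "card S = r + k - 1"
  shows "card {x \<in> {1..n}. servers m B x \<subseteq> S} \<le> k - 1"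
proof (rule ccontr)
  assume "\<not> ?thesis"
  then have "k \<le> card {x \<in> {1..n}. servers m B x \<subseteq> S}" using \<open>1 \<le> k\<close> by linarith
  then obtain Y where Y: "Y \<subseteq> {x \<in> {1..n}. servers m B x \<subseteq> S}" "card Y = k"
    by (meson obtain_subset_with_card_n)
  have finS: "finite S" using S(1) finite_subset by blast
  have "r \<le> card S" using S(2) \<open>1 \<le> k\<close> by simp
  then obtain R where R: "R \<subseteq> S" "card R = r"
    by (meson obtain_subset_with_card_n)
  have finR: "finite R" using R(1) finS finite_subset by blast
  have "card ({1..m} - R) = m - r"
    using R S(1) finR by (simp add: card_Diff_subset)
  moreover have "Y \<subseteq> {1..n}" using Y(1) by blast
  ultimately obtain C where C: "\<forall>j\<in>{1..m} - R. C j \<subseteq> B j \<and> card (C j) \<le> 1"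
      and YC: "Y = (\<Union>j\<in>{1..m} - R. C j)"
    using ecbc Y(2) unfolding is_ecbc_def by (metis Diff_subset order_refl)
  have "Y \<subseteq> (\<Union>j\<in>S - R. C j)"
  proof
    fix y assume "y \<in> Y"
    then obtain j where j: "j \<in> {1..m} - R" "y \<in> C j" using YC by blast
    then have "j \<in> servers m B y" using C unfolding servers_def by blast
    then show "y \<in> (\<Union>j\<in>S - R. C j)" using Y(1) \<open>y \<in> Y\<close> j by blast
  qed
  moreover have "finite (\<Union>j\<in>S - R. C j)"
  proof (rule finite_subset)
    show "(\<Union>j\<in>S - R. C j) \<subseteq> Y" using YC S(1) by blast
    show "finite Y" using Y(1) finite_subset by fastforce
  qed
  ultimately have "k \<le> card (\<Union>j\<in>S - R. C j)"
    using Y(2) card_mono by blast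
  also have "\<dots> \<le> (\<Sum>j\<in>S - R. card (C j))"
    using finS by (intro card_UN_le) simp
  also have "\<dots> \<le> card (S - R) * 1"
    using C S(1) sum_bounded_above[of "S - R" "\<lambda>j. card (C j)" 1] by auto
  also have "\<dots> = k - 1"
    using R S(2) finR \<open>1 \<le> k\<close> by (simp add: card_Diff_subset)
  finally show False using \<open>1 \<le> k\<close> by linarith
qed

text \<open>
  Enlarge \<open>T\<close> to a set \<open>U\<close> with \<open>s + 1\<close> elements; deleting from \<open>U\<close> any one of its elements
  outside \<open>T\<close> leaves a superset of \<open>T\<close> of size \<open>s\<close>.
\<close>

lemma deficiency_le_supersets:
  fixes M :: "'a set"
  assumes "finite M" "T \<subseteq> M" "s < card M"
  shows "Suc s - card T \<le> card {S. S \<subseteq> M \<and> card S = s \<and> T \<subseteq> S}"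
proof (cases "card T \<le> Suc s")
  case True
  have finT: "finite T" using assms finite_subset by blast
  have "Suc s - card T \<le> card (M - T)"
    using assms finT by (simp add: card_Diff_subset)
  then obtain V where V: "V \<subseteq> M - T" "card V = Suc s - card T" "finite V"
    using assms(1) by (meson obtain_subset_with_card_n finite_Diff finite_subset)
  let ?U = "T \<union> V"
  have cardU: "card ?U = Suc s"
    using V True finT by (subst card_Un_disjoint) auto
  have "inj_on (\<lambda>v. ?U - {v}) V" unfolding inj_on_def by blast
  then have "card V = card ((\<lambda>v. ?U - {v}) ` V)" by (simp add: card_image)
  also have "\<dots> \<le> card {S. S \<subseteq> M \<and> card S = s \<and> T \<subseteq> S}"
  proof (rule card_mono)
    show "finite {S. S \<subseteq> M \<and> card S = s \<and> T \<subseteq> S}" using assms(1) by simp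
    show "(\<lambda>v. ?U - {v}) ` V \<subseteq> {S. S \<subseteq> M \<and> card S = s \<and> T \<subseteq> S}"
    proof
      fix S assume "S \<in> (\<lambda>v. ?U - {v}) ` V"
      then obtain v where v: "v \<in> V" "S = ?U - {v}" by blast
      then have "card S = s" using cardU by simp
      then show "S \<in> {S. S \<subseteq> M \<and> card S = s \<and> T \<subseteq> S}"
        using v V(1) assms(2) by blast
    qed
  qed
  finally show ?thesis using V(2) by simp
qed simp

lemma weight_lower_bound:
  assumes ecbc: "is_ecbc r n k m B" and "1 \<le> k" "r + k \<le> m"
  shows "(r + k) * n \<le> weight m B + (k - 1) * (m choose (r + k - 1))"
proof -
  let ?T = "servers m B"
  define \<S> where "\<S> = {S. S \<subseteq> {1..m} \<and> card S = r + k - 1}"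
  have fin\<S>: "finite \<S>" unfolding \<S>_def by simp
  have card\<S>: "card \<S> = m choose (r + k - 1)"
    unfolding \<S>_def using n_subsets[of "{1..m}"] by simp
  have deficiency: "r + k - card (?T x) \<le> card {S \<in> \<S>. ?T x \<subseteq> S}" for x
  proof -
    have "?T x \<subseteq> {1..m}" unfolding servers_def by blast
    then show ?thesis
      using deficiency_le_supersets[of "{1..m}" "?T x" "r + k - 1"] assms(2,3)
      by (simp add: \<S>_def conj_assoc)
  qed
  have B: "\<forall>j\<in>{1..m}. B j \<subseteq> {1..n}" using ecbc unfolding is_ecbc_def by blast
  have "(r + k) * n = (\<Sum>x\<in>{1..n}. r + k)" by simp
  also have "\<dots> \<le> (\<Sum>x\<in>{1..n}. card (?T x) + card {S \<in> \<S>. ?T x \<subseteq> S})"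
    using deficiency by (intro sum_mono) (simp add: add.commute le_diff_conv)
  also have "\<dots> = weight m B + (\<Sum>x\<in>{1..n}. card {S \<in> \<S>. ?T x \<subseteq> S})"
    by (simp only: sum.distrib weight_eq_sum_servers[OF B])
  also have "(\<Sum>x\<in>{1..n}. card {S \<in> \<S>. ?T x \<subseteq> S})
      = (\<Sum>x\<in>{1..n}. \<Sum>S\<in>\<S>. if ?T x \<subseteq> S then 1 else 0)"
    using fin\<S> by (simp flip: sum.inter_filter)
  also have "\<dots> = (\<Sum>S\<in>\<S>. \<Sum>x\<in>{1..n}. if ?T x \<subseteq> S then 1 else 0)"
    by (rule sum.swap)
  also have "\<dots> = (\<Sum>S\<in>\<S>. card {x \<in> {1..n}. ?T x \<subseteq> S})"
    by (simp flip: sum.inter_filter)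
  also have "\<dots> \<le> (\<Sum>S\<in>\<S>. k - 1)"
    using few_items_inside[OF ecbc \<open>1 \<le> k\<close>] by (intro sum_mono) (simp add: \<S>_def)
  also have "\<dots> = (k - 1) * (m choose (r + k - 1))"
    by (simp add: card\<S>)
  finally show ?thesis by simp
qed

section \<open>Distinct representatives\<close>

text \<open>
  The greedy choice works for \<open>Z\<close> because, when an element of \<open>Z\<close> is treated, fewer than
  \<open>card (X \<union> Z)\<close> values are taken.
\<close>

lemma distinct_reps_extend:
  assumes "finite Z" "finite X" "X \<inter> Z = {}"
    and "inj_on f X" "\<forall>x\<in>X. f x \<in> A x"
    and "\<forall>z\<in>Z. card (X \<union> Z) \<le> card (A z)"
  shows "\<exists>g. inj_on g (X \<union> Z) \<and> (\<forall>y\<in>X \<union> Z. g y \<in> A y) \<and> (\<forall>x\<in>X. g x = f x)"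
  using assms
proof (induction Z)
  case empty
  then show ?case by auto
next
  case (insert z Z)
  have card_insert_z: "card (X \<union> insert z Z) = Suc (card (X \<union> Z))"
    using insert by simp
  have "\<forall>y\<in>Z. card (X \<union> Z) \<le> card (A y)"
    using insert.prems(5) card_insert_z by fastforce
  then obtain g where g: "inj_on g (X \<union> Z)" "\<forall>y\<in>X \<union> Z. g y \<in> A y" "\<forall>x\<in>X. g x = f x"
    using insert by auto
  have "card (g ` (X \<union> Z)) < card (A z)"
    using insert.prems(5) card_insert_z card_image_le[of "X \<union> Z" g] insert.prems(1) insert.hyps(1)
    by fastforce
  then obtain v where v: "v \<in> A z" "v \<notin> g ` (X \<union> Z)"
    using insert.prems(1) insert.hyps(1)
    by (metis card_mono finite_UnI finite_imageI not_le subsetI)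
  have z: "z \<notin> X \<union> Z" using insert by blast
  then have upd: "(g(z := v)) y = g y" if "y \<in> X \<union> Z" for y
    using that by (metis fun_upd_other)
  have "inj_on (g(z := v)) (insert z (X \<union> Z))"
    using g(1) v(2) z upd by (auto simp: inj_on_def)
  moreover have "\<forall>y\<in>insert z (X \<union> Z). (g(z := v)) y \<in> A y"
    using g(2) v(1) upd by (metis fun_upd_same insertE)
  moreover have "\<forall>x\<in>X. (g(z := v)) x = f x"
    using g(3) upd by (metis UnI1)
  ultimately show ?case unfolding Un_insert_right by blast
qed

text \<open>
  Treat an element \<open>y\<close> with a set \<open>A y\<close> of the smallest allowed size last.  The greedy choice can
  only get stuck at \<open>y\<close>, and only if the others use up exactly \<open>A y\<close>.  This is avoided by spending at the very beginning a value outside \<open>A y\<close>; such a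
  value exists because the union is larger than \<open>A y\<close>.
\<close>

lemma distinct_reps_of_card:
  assumes finY: "finite Y" and finA: "\<forall>y\<in>Y. finite (A y)"
    and each: "\<forall>y\<in>Y. card Y - 1 \<le> card (A y)"
    and union: "card Y \<le> card (\<Union>y\<in>Y. A y)"
  shows "\<exists>f. inj_on f Y \<and> (\<forall>y\<in>Y. f y \<in> A y)"
proof (cases "\<forall>y\<in>Y. card Y \<le> card (A y)")
  case True
  then show ?thesis using distinct_reps_extend[of Y "{}" undefined A] finY by simp
next
  case False
  then obtain y where y: "y \<in> Y" "card (A y) < card Y" by force
  then have "card (A y) < card (\<Union>y\<in>Y. A y)" using union by linarith
  then obtain x v where x: "x \<in> Y" "v \<in> A x" "v \<notin> A y"
    using finA y(1) by (metis UN_iff card_mono not_le subsetI)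
  have "x \<noteq> y" using x by blast
  let ?Z = "Y - {x, y}"
  have Y1: "{x} \<union> ?Z = Y - {y}" using x(1) \<open>x \<noteq> y\<close> by blast
  have card1: "card (Y - {y}) = card Y - 1" using y(1) finY by simp
  obtain g where g: "inj_on g (Y - {y})" "\<forall>z\<in>Y - {y}. g z \<in> A z" "g x = v"
    using distinct_reps_extend[of ?Z "{x}" "\<lambda>_. v" A] finY x(2) each card1 unfolding Y1 by auto
  \<comment> \<open>The value \<open>v\<close> does not compete for \<open>A y\<close>, so at most \<open>card Y - 2\<close> elements of \<open>A y\<close> are taken.\<close>
  have "A y \<inter> g ` (Y - {y}) \<subseteq> g ` ?Z"
    using g(3) x(3) by blast
  then have "card (A y \<inter> g ` (Y - {y})) \<le> card ?Z"
    using finY by (meson card_image_le card_mono finite_Diff finite_imageI le_trans)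
  also have "\<dots> < card (Y - {y})"
    using finY x(1) \<open>x \<noteq> y\<close> by (intro psubset_card_mono) auto
  also have "\<dots> \<le> card (A y)" using card1 each y(1) by simp
  finally have "\<not> A y \<subseteq> g ` (Y - {y})"
    by (metis inf.absorb1 less_irrefl)
  then obtain w where w: "w \<in> A y" "w \<notin> g ` (Y - {y})" by blast
  have "inj_on (g(y := w)) Y"
    using g(1) w(2) by (auto simp: inj_on_def)
  moreover have "\<forall>z\<in>Y. (g(y := w)) z \<in> A z" using g(2) w(1) by simp
  ultimately show ?thesis by blast
qed

section \<open>The construction\<close>

text \<open>
  The condition on \<open>W\<close> is the only obstruction: when at most \<open>r\<close> servers fail and \<open>k\<close> items are
  left with \<open>k - 1\<close> servers in total, they all live on the same \<open>r + k - 1\<close> servers \<open>W\<close>, the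
  failed ones included.
\<close>

lemma is_ecbc_of_server_sets:
  assumes "1 \<le> k"
    and T: "\<forall>x\<in>{1..n}. T x \<subseteq> {1..m} \<and> r + k - 1 \<le> card (T x)"
    and few: "\<And>W. card W = r + k - 1 \<Longrightarrow> card {x \<in> {1..n}. T x = W} \<le> k - 1"
  shows "is_ecbc r n k m (\<lambda>j. {x \<in> {1..n}. j \<in> T x})"
  unfolding is_ecbc_def
proof (intro conjI allI impI ballI)
  fix Y J :: "nat set"
  assume *: "Y \<subseteq> {1..n} \<and> card Y \<le> k \<and> J \<subseteq> {1..m} \<and> card J \<ge> m - r"
  let ?F = "{1..m} - J" and ?A = "\<lambda>y. T y \<inter> J"
  have finY: "finite Y" and finJ: "finite J"
    using * finite_subset by blast+
  have "card ?F = m - card J"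
    using * finJ by (simp add: card_Diff_subset)
  then have cardF: "card ?F \<le> r" using * by linarith
  have surviving: "k - 1 \<le> card (?A y)" if "y \<in> Y" for y
  proof -
    have y: "T y \<subseteq> {1..m}" "r + k - 1 \<le> card (T y)" using T * that by blast+
    have "T y \<subseteq> ?A y \<union> ?F" using y(1) by blast
    then have "card (T y) \<le> card (?A y \<union> ?F)"
      using finJ by (intro card_mono) auto
    also have "\<dots> \<le> card (?A y) + card ?F" by (rule card_Un_le)
    finally show ?thesis using y(2) cardF by linarith
  qed
  have "card Y \<le> card (\<Union>y\<in>Y. ?A y)"
  proof (rule ccontr)
    let ?W = "(\<Union>y\<in>Y. ?A y) \<union> ?F"
    assume less: "\<not> card Y \<le> card (\<Union>y\<in>Y. ?A y)"
    have finU: "finite (\<Union>y\<in>Y. ?A y)" using finY finJ by blast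
    have "card ?W \<le> card (\<Union>y\<in>Y. ?A y) + card ?F" by (rule card_Un_le)
    then have W: "card ?W \<le> r + k - 1" using cardF less * by linarith
    have TW: "T y = ?W" if "y \<in> Y" for y
    proof (rule card_seteq)
      show "finite ?W" using finU by simp
      have y: "T y \<subseteq> {1..m}" "r + k - 1 \<le> card (T y)" using T * that by blast+
      show "T y \<subseteq> ?W" using y(1) that by blast
      show "card ?W \<le> card (T y)" using W y(2) by linarith
    qed
    obtain y where y: "y \<in> Y" using less by fastforce
    have "card ?W = r + k - 1" using TW[OF y] W T * y by (metis le_antisym subsetD)
    moreover have "Y \<subseteq> {x \<in> {1..n}. T x = ?W}"
      using TW * by blast
    ultimately have "card Y \<le> k - 1"
      using few[of ?W] card_mono[of "{x \<in> {1..n}. T x = ?W}" Y] by simp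
    also have "\<dots> \<le> card (?A y)" using surviving y by blast
    also have "\<dots> \<le> card (\<Union>y\<in>Y. ?A y)" using finU y by (intro card_mono) blast+
    finally show False using less by simp
  qed
  moreover have "\<forall>y\<in>Y. card Y - 1 \<le> card (?A y)"
    using surviving * by (meson diff_le_mono le_trans)
  ultimately obtain f where f: "inj_on f Y" "\<forall>y\<in>Y. f y \<in> ?A y"
    using distinct_reps_of_card[of Y ?A] finY finJ by auto
  let ?C = "\<lambda>j. {y \<in> Y. f y = j}"
  have "card (?C j) \<le> 1" for j
    using f(1) finY by (simp add: card_le_Suc0_iff_eq inj_on_def)
  moreover have "?C j \<subseteq> {x \<in> {1..n}. j \<in> T x}" for j
    using f(2) * by blast
  moreover have "Y = (\<Union>j\<in>J. ?C j)"
    using f(2) by blast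
  ultimately show "\<exists>C. (\<forall>j\<in>J. C j \<subseteq> {x \<in> {1..n}. j \<in> T x} \<and> card (C j) \<le> 1) \<and>
      Y = (\<Union>j\<in>J. C j)"
    by (intro exI[of _ ?C] conjI ballI)
qed blast

lemma exists_optimal_ecbc:
  assumes "1 \<le> k" "r + k \<le> m" and n: "(k - 1) * (m choose (r + k - 1)) \<le> n"
  shows "\<exists>B. is_ecbc r n k m B \<and>
    weight m B + (k - 1) * (m choose (r + k - 1)) = (r + k) * n"
proof -
  define \<S> where "\<S> = {S. S \<subseteq> {1..m} \<and> card S = r + k - 1}"
  define N where "N = (k - 1) * (m choose (r + k - 1))"
  have fin: "finite (\<S> \<times> {..<k - 1})" unfolding \<S>_def by simp
  have "card (\<S> \<times> {..<k - 1}) = card {1..N}"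
    unfolding \<S>_def N_def using n_subsets[of "{1..m}" "r + k - 1"]
    by (simp add: card_cartesian_product)
  \<comment> \<open>Pairing the first \<open>N\<close> items with \<open>\<S> \<times> {..<k - 1}\<close> gives each set of \<open>\<S>\<close> exactly \<open>k - 1\<close> items.\<close>
  then obtain h where h: "bij_betw h {1..N} (\<S> \<times> {..<k - 1})"
    using fin by (metis finite_same_card_bij finite_atLeastAtMost)
  define T where "T x = (if x \<le> N then fst (h x) else {1..r + k})" for x
  have short: "T x \<in> \<S>" if "x \<in> {1..N}" for x
    using that bij_betwE[OF h] by (auto simp: T_def mem_Times_iff)
  have T: "T x \<subseteq> {1..m}" "card (T x) = (if x \<le> N then r + k - 1 else r + k)"
    if "x \<in> {1..n}" for x
    using short[of x] that assms(2) by (auto simp: \<S>_def T_def)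
  have few: "card {x \<in> {1..n}. T x = W} \<le> k - 1" if W: "card W = r + k - 1" for W
  proof -
    have sub: "{x \<in> {1..n}. T x = W} \<subseteq> {1..N}"
    proof
      fix x assume "x \<in> {x \<in> {1..n}. T x = W}"
      then have x: "x \<in> {1..n}" and "card (T x) = r + k - 1" using W by blast+
      then have "x \<le> N" using T(2)[OF x] assms(1) by (cases "x \<le> N") simp_all
      then show "x \<in> {1..N}" using x by simp
    qed
    have "h ` {x \<in> {1..n}. T x = W} \<subseteq> {W} \<times> {..<k - 1}"
    proof (rule image_subsetI)
      fix x assume x: "x \<in> {x \<in> {1..n}. T x = W}"
      then have "x \<in> {1..N}" using sub by blast
      moreover from this have "fst (h x) = W" using x by (simp add: T_def)
      ultimately show "h x \<in> {W} \<times> {..<k - 1}"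
        using bij_betwE[OF h] by (auto simp: mem_Times_iff)
    qed
    moreover have "inj_on h {x \<in> {1..n}. T x = W}"
      using h sub by (meson bij_betw_def inj_on_subset)
    ultimately have "card {x \<in> {1..n}. T x = W} \<le> card ({W} \<times> {..<k - 1})"
      by (intro card_inj_on_le) auto
    then show ?thesis by (simp add: card_cartesian_product)
  qed
  define B where "B j = {x \<in> {1..n}. j \<in> T x}" for j
  have "is_ecbc r n k m B"
    unfolding B_def using T few assms(1) by (intro is_ecbc_of_server_sets) auto
  moreover have "weight m B + N = (r + k) * n"
  proof -
    have "servers m B x = T x" if "x \<in> {1..n}" for x
      using T(1)[OF that] that by (auto simp: servers_def B_def)
    moreover have "\<forall>j\<in>{1..m}. B j \<subseteq> {1..n}" unfolding B_def by blast
    ultimately have "weight m B = (\<Sum>x\<in>{1..n}. card (T x))"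
      by (simp add: weight_eq_sum_servers)
    moreover have "N = (\<Sum>x\<in>{1..n}. if x \<le> N then 1 else 0)"
    proof -
      have "{x \<in> {1..n}. x \<le> N} = {1..N}" using n unfolding N_def by auto
      then show ?thesis by (simp flip: sum.inter_filter)
    qed
    ultimately have "weight m B + N = (\<Sum>x\<in>{1..n}. card (T x) + (if x \<le> N then 1 else 0))"
      by (simp add: sum.distrib)
    also have "\<dots> = (\<Sum>x\<in>{1..n}. r + k)"
      using T(2) assms(1) by (intro sum.cong) auto
    finally show ?thesis by simp
  qed
  ultimately show ?thesis unfolding N_def by blast
qed

section \<open>The minimum weight\<close>

theorem theorem12:
  fixes r m n k :: nat
  assumes "1 \<le> k" and "r + k \<le> m" and "k \<le> n"
    and "n \<ge> (k - 1) * (m choose (r + k - 1))"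
  shows "int (min_weight n k m r) =
           (int r + int k) * int n - (int k - 1) * int (m choose (r + k - 1))"
proof -
  let ?N = "(k - 1) * (m choose (r + k - 1))"
  have "k \<le> m - r" using assms(2) by linarith
  then obtain B where "is_ecbc r n k m B" "min_weight n k m r = weight m B"
    using min_weight_attained by blast
  then have "(r + k) * n \<le> min_weight n k m r + ?N"
    using weight_lower_bound assms(1,2) by metis
  moreover have "min_weight n k m r + ?N \<le> (r + k) * n"
    using exists_optimal_ecbc[OF assms(1,2,4)] min_weight_le by (metis add_le_mono1)
  ultimately have "int (min_weight n k m r + ?N) = int ((r + k) * n)"
    by (simp only: le_antisym)
  then have "int (min_weight n k m r) = int ((r + k) * n) - int ?N" by linarith
  then show ?thesis using assms(1) by (simp add: of_nat_diff)
qed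

end
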